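(* Consider problem (P) and the Jacobi-style update described in the context. There is a constant $\hat L>0$, independent of $k$ and of the iterates, such that for every $k$, if $x_i^{k+1}$, $i=1,\dots,N-1$, are obtained from $(x_1^k,\dots,x_N^k,\lambda^k)$ by the Jacobi-style update, then $$\mathcal L_\beta(x_1^{k+1},\dots,x_{N-1}^{k+1},x_N^k,\lambda^k)\le\mathcal L_\beta(x_1^k,\dots,x_N^k,\lambda^k)-\sum_{i=1}^{N-1}\|x_i^k-x_i^{k+1}\|^2_{\frac{H_i}2-\frac{\hat L}2I}.$$
   Context: Problem (P): minimize $f(x_1,\dots,x_N)+\sum_{i=1}^{N-1}r_i(x_i)$ subject to $\sum_{i=1}^N A_ix_i=b$ with $A_N=I$, $x_N\in\mathbb R^{n_N}$, and $x_i\in\mathcal M_i\cap X_i$ for $i=1,\dots,N-1$. Here $A_i\in\mathbb R^{m\times n_i}$, $b\in\mathbb R^m$, $n_N=m$; $f:\mathbb R^{n_1}\times\cdots\times\mathbb R^{n_N}\to\mathbb R$ is smooth (possibly nonconvex) with $L$-Lipschitz gradient, $L>0$; $r_i:\mathbb R^{n_i}\to\mathbb R$ is convex and locally Lipschitz; $\mathcal M_i$ is a Riemannian submanifold embedded in $\mathbb R^{n_i}$; $X_i\subset\mathbb R^{n_i}$ is closed and convex. Let $\beta>0$, $H_i$ symmetric positive definite, $\|v\|_H^2=v^\top Hv$, and $\mathcal L_\beta(x_1,\dots,x_N,\lambda)=f(x_1,\dots,x_N)+\sum_{i=1}^{N-1}r_i(x_i)-\langle\sum_{i=1}^N A_ix_i-b,\lambda\rangle+\frac\beta2\|\sum_{i=1}^N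 A_ix_i-b\|^2$. Let $\bar f_\beta(x_1,\dots,x_N)=f(x_1,\dots,x_N)+\frac\beta2\|\sum_{j=1}^N A_jx_j-b\|^2$ and $\bar{\mathcal L}^i_\beta(x_i;\hat x_1,\dots,\hat x_N,\lambda)=\bar f_\beta(\hat x)+\langle\nabla_i\bar f_\beta(\hat x),x_i-\hat x_i\rangle-\langle\sum_{j\ne i}A_j\hat x_j+A_ix_i-b,\lambda\rangle+r_i(x_i)$. Jacobi-style update: given $x_i^k\in\mathcal M_i\cap X_i$ ($i\le N-1$), $x_N^k\in\mathbb R^{n_N}$ and $\lambda^k\in\mathbb R^m$, for each $i=1,\dots,N-1$ (in parallel) $x_i^{k+1}$ is a global minimizer (assumed to exist) over $x_i\in\mathcal M_i\cap X_i$ of $\bar{\mathcal L}^i_\beta(x_i;x_1^k,\dots,x_N^k,\lambda^k)+\frac12\|x_i-x_i^k\|_{H_i}^2$. *)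

theory Defs
  imports "HOL-Analysis.Analysis"
begin

(* Encoding of R^{n_1} x ... x R^{n_N} with block dimensions n_i that vary with i:
   the product is real^'n, and blk :: 'n => nat maps each coordinate to the number of the block
   it belongs to, so n_i is the number of coordinates c with blk c = i.
   The factor R^{n_i} is the coordinate subspace of the vectors supported on block i. *)

definition block_space :: "('n::finite \<Rightarrow> nat) \<Rightarrow> nat \<Rightarrow> (real^'n) set" where
  "block_space blk i = {v. \<forall>c. blk c \<noteq> i \<longrightarrow> v $ c = 0}"

definition block :: "('n::finite \<Rightarrow> nat) \<Rightarrow> nat \<Rightarrow> real^'n \<Rightarrow> real^'n" where
  "block blk i x = (\<chi> c. if blk c = i then x $ c else 0)"

definition replace_block :: "('n::finite \<Rightarrow> nat) \<Rightarrow> nat \<Rightarrow> real^'n \<Rightarrow> real^'n \<Rightarrow> real^'n" where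
  "replace_block blk i x z = (\<chi> c. if blk c = i then z $ c else x $ c)"

definition grad :: "('a::real_inner \<Rightarrow> real) \<Rightarrow> 'a \<Rightarrow> 'a" where
  "grad g x = (THE D. GDERIV g x :> D)"

definition block_grad :: "('n::finite \<Rightarrow> nat) \<Rightarrow> nat \<Rightarrow> (real^'n \<Rightarrow> real) \<Rightarrow> real^'n \<Rightarrow> real^'n" where
  "block_grad blk i g x = block blk i (grad g x)"

definition locally_lipschitz_on :: "'a::metric_space set \<Rightarrow> ('a \<Rightarrow> 'b::metric_space) \<Rightarrow> bool" where
  "locally_lipschitz_on S g \<longleftrightarrow> (\<forall>x\<in>S. \<exists>e>0. \<exists>C. C-lipschitz_on (cball x e \<inter> S) g)"

(* Ck_on k E U g: g is of class C^k on U, where U is relatively open in the subspace E;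
   only derivatives in directions of E are used. *)

primrec Ck_on :: "nat \<Rightarrow> 'a::euclidean_space set \<Rightarrow> 'a set \<Rightarrow> ('a \<Rightarrow> 'b::euclidean_space) \<Rightarrow> bool" where
  "Ck_on 0 E U g \<longleftrightarrow> continuous_on U g"
| "Ck_on (Suc k) E U g \<longleftrightarrow>
     (\<forall>v\<in>E. (\<forall>x\<in>U. (\<lambda>t::real. g (x + t *\<^sub>R v)) differentiable (at 0)) \<and>
            Ck_on k E U (\<lambda>x. vector_derivative (\<lambda>t. g (x + t *\<^sub>R v)) (at 0)))"

definition smooth_rel :: "'a::euclidean_space set \<Rightarrow> 'a set \<Rightarrow> ('a \<Rightarrow> 'b::euclidean_space) \<Rightarrow> bool" where
  "smooth_rel E U g \<longleftrightarrow> (\<forall>k. Ck_on k E U g)"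

(* Embedded smooth submanifold, of some dimension d, of the Euclidean space E (slice charts).
   As a Riemannian submanifold it carries the metric induced by the inner product of E, which is
   determined by the set M. *)

definition embedded_submanifold :: "'a::euclidean_space set \<Rightarrow> 'a set \<Rightarrow> bool" where
  "embedded_submanifold E M \<longleftrightarrow> M \<subseteq> E \<and>
     (\<exists>d. \<forall>p\<in>M. \<exists>U V \<phi> \<psi> S.
        openin (top_of_set E) U \<and> p \<in> U \<and> openin (top_of_set E) V \<and>
        homeomorphism U V \<phi> \<psi> \<and> smooth_rel E U \<phi> \<and> smooth_rel E V \<psi> \<and>
        subspace S \<and> S \<subseteq> E \<and> dim S = d \<and> \<phi> ` (U \<inter> M) = V \<inter> S)"

(* Matrices on R^{n_i} are stored as real^'n^'n and only their entries in rows and columns of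
   block i count; likewise for the columns of the A_i.  The identification n_N = m is a bijection
   sigma from the index type 'm onto the coordinates of block N, and A_N = I is read along it. *)

definition sym_pos_def_block :: "('n::finite \<Rightarrow> nat) \<Rightarrow> nat \<Rightarrow> real^'n^'n \<Rightarrow> bool" where
  "sym_pos_def_block blk i H \<longleftrightarrow>
     (\<forall>c d. blk c = i \<longrightarrow> blk d = i \<longrightarrow> H $ c $ d = H $ d $ c) \<and>
     (\<forall>v\<in>block_space blk i. v \<noteq> 0 \<longrightarrow> 0 < v \<bullet> (H *v v))"

definition sqnorm_mat :: "real^'n^'n \<Rightarrow> real^'n \<Rightarrow> real" where
  "sqnorm_mat H v = v \<bullet> (H *v v)"

definition residual ::
  "('n::finite \<Rightarrow> nat) \<Rightarrow> nat \<Rightarrow> (nat \<Rightarrow> real^'n^'m) \<Rightarrow> real^'m \<Rightarrow> real^'n \<Rightarrow> real^'m" where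
  "residual blk N A b x = (\<Sum>i\<in>{1..N}. A i *v block blk i x) - b"

definition aug_lagrangian ::
  "('n::finite \<Rightarrow> nat) \<Rightarrow> nat \<Rightarrow> (real^'n \<Rightarrow> real) \<Rightarrow> (nat \<Rightarrow> real^'n \<Rightarrow> real) \<Rightarrow>
   (nat \<Rightarrow> real^'n^'m) \<Rightarrow> real^'m \<Rightarrow> real \<Rightarrow> real^'n \<Rightarrow> real^'m \<Rightarrow> real" where
  "aug_lagrangian blk N f r A b \<beta> x lam =
     f x + (\<Sum>i\<in>{1..<N}. r i (block blk i x)) - residual blk N A b x \<bullet> lam
     + \<beta> / 2 * (norm (residual blk N A b x))\<^sup>2"

definition fbar ::
  "('n::finite \<Rightarrow> nat) \<Rightarrow> nat \<Rightarrow> (real^'n \<Rightarrow> real) \<Rightarrow>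
   (nat \<Rightarrow> real^'n^'m) \<Rightarrow> real^'m \<Rightarrow> real \<Rightarrow> real^'n \<Rightarrow> real" where
  "fbar blk N f A b \<beta> x = f x + \<beta> / 2 * (norm (residual blk N A b x))\<^sup>2"

definition Lbar ::
  "('n::finite \<Rightarrow> nat) \<Rightarrow> nat \<Rightarrow> (real^'n \<Rightarrow> real) \<Rightarrow> (nat \<Rightarrow> real^'n \<Rightarrow> real) \<Rightarrow>
   (nat \<Rightarrow> real^'n^'m) \<Rightarrow> real^'m \<Rightarrow> real \<Rightarrow> nat \<Rightarrow> real^'n \<Rightarrow> real^'n \<Rightarrow> real^'m \<Rightarrow> real" where
  "Lbar blk N f r A b \<beta> i xi xhat lam =
     fbar blk N f A b \<beta> xhat
     + block_grad blk i (fbar blk N f A b \<beta>) xhat \<bullet> (xi - block blk i xhat)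
     - ((\<Sum>j\<in>{1..N} - {i}. A j *v block blk j xhat) + A i *v xi - b) \<bullet> lam
     + r i xi"

(* Only the blocks 1..N-1 of xnew are constrained. *)

definition jacobi_update ::
  "('n::finite \<Rightarrow> nat) \<Rightarrow> nat \<Rightarrow> (real^'n \<Rightarrow> real) \<Rightarrow> (nat \<Rightarrow> real^'n \<Rightarrow> real) \<Rightarrow>
   (nat \<Rightarrow> real^'n^'m) \<Rightarrow> real^'m \<Rightarrow> real \<Rightarrow> (nat \<Rightarrow> (real^'n) set) \<Rightarrow> (nat \<Rightarrow> (real^'n) set) \<Rightarrow>
   (nat \<Rightarrow> real^'n^'n) \<Rightarrow> real^'n \<Rightarrow> real^'m \<Rightarrow> real^'n \<Rightarrow> bool" where
  "jacobi_update blk N f r A b \<beta> M X H x lam xnew \<longleftrightarrow>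
     (\<forall>i\<in>{1..<N}. block blk i x \<in> M i \<inter> X i) \<and>
     (\<forall>i\<in>{1..<N}.
        is_arg_min
          (\<lambda>xi. Lbar blk N f r A b \<beta> i xi x lam + 1 / 2 * sqnorm_mat (H i) (xi - block blk i x))
          (\<lambda>xi. xi \<in> M i \<inter> X i)
          (block blk i xnew))"

end

theory Submission
  imports Defs
begin

text \<open>The augmented Lagrangian is \<open>fbar\<close>, whose gradient is Lipschitz, plus terms that split over the
  blocks. By the descent lemma, \<open>fbar\<close> increases by at most its linearization plus \<open>Lhat / 2\<close> times the
  squared step. As the linearization and the squared step also split over the blocks, summing the
  optimality inequalities of the block subproblems, each compared with the old block, gives the claim;
  block \<open>N\<close> does not move.\<close>

section \<open>Gradients and the descent lemma\<close>

lemma GDERIV_grad: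
  fixes f :: "'a::euclidean_space \<Rightarrow> real"
  assumes "f differentiable (at x)"
  shows "GDERIV f x :> grad f x"
proof -
  obtain f' where f': "(f has_derivative f') (at x)"
    using assms by (auto simp: differentiable_def)
  then have "linear f'"
    by (rule has_derivative_linear)
  \<comment> \<open>Riesz representation: the adjoint of \<open>f'\<close> goes from the reals back
    to the space, so its value at 1 represents \<open>f'\<close>.\<close>
  then have "f' = (\<lambda>h. h \<bullet> adjoint f' 1)"
    by (auto simp: adjoint_works)
  with f' have D: "GDERIV f x :> adjoint f' 1"
    by (simp add: gderiv_def)
  \<comment> \<open>\<open>grad\<close> is a definite description, so uniqueness is needed besides
    existence.\<close>
  have "D' = adjoint f' 1" if "GDERIV f x :> D'" for D'
  proof -
    have "(\<lambda>h. h \<bullet> D') = (\<lambda>h. h \<bullet> adjoint f' 1)"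
      using that D unfolding gderiv_def by (rule has_derivative_unique)
    then show ?thesis
      by (metis inner_commute vector_eq_ldot)
  qed
  with D show ?thesis
    unfolding grad_def by (rule theI)
qed

lemma has_derivative_eq_inner_grad:
  fixes f :: "'a::euclidean_space \<Rightarrow> real"
  assumes f': "(f has_derivative f') (at x)"
  shows "f' h = grad f x \<bullet> h"
proof -
  have "GDERIV f x :> grad f x"
    using f' by (intro GDERIV_grad) (auto simp: differentiable_def)
  then have "f' = (\<lambda>h. h \<bullet> grad f x)"
    using f' unfolding gderiv_def by (intro has_derivative_unique)
  then show ?thesis
    by (simp add: inner_commute)
qed

text \<open>The gradient at distance \<open>t * norm d\<close> from \<open>x\<close> has drifted by
  at most \<open>L * t * norm d\<close>; accumulating this drift along the segment yields the factor
  \<open>L / 2\<close>. A monotonicity argument replaces the integral.\<close>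

lemma descent_lemma:
  fixes f :: "'a::euclidean_space \<Rightarrow> real"
  assumes diff: "\<And>x. f differentiable (at x)"
    and lip: "L-lipschitz_on UNIV (grad f)"
  shows "f (x + d) \<le> f x + grad f x \<bullet> d + L / 2 * (norm d)\<^sup>2"
proof -
  \<comment> \<open>\<open>f\<close> along the segment, less the linear and quadratic terms of the
    bound for the step \<open>t *\<^sub>R d\<close>. Since \<open>g 0 = f x\<close>, the claim is
    \<open>g 1 \<le> g 0\<close>.\<close>
  define g where "g t = f (x + t *\<^sub>R d) - t * (grad f x \<bullet> d) - L / 2 * t\<^sup>2 * (norm d)\<^sup>2" for t
  have "\<exists>y. (g has_real_derivative y) (at t) \<and> y \<le> 0" if "0 \<le> t" for t
  proof -
    have "((\<lambda>t. f (x + t *\<^sub>R d)) has_derivative (\<lambda>s. (s *\<^sub>R d) \<bullet> grad f (x + t *\<^sub>R d))) (at t)"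
      using GDERIV_grad[OF diff] unfolding gderiv_def
      by (intro has_derivative_compose[where f = "\<lambda>t. x + t *\<^sub>R d" and g = f])
        (auto intro!: derivative_eq_intros)
    then have f': "((\<lambda>t. f (x + t *\<^sub>R d)) has_real_derivative grad f (x + t *\<^sub>R d) \<bullet> d) (at t)"
      unfolding has_field_derivative_def
      by (rule has_derivative_eq_rhs) (auto simp: inner_commute)
    have g': "(g has_real_derivative
        (grad f (x + t *\<^sub>R d) - grad f x) \<bullet> d - L * t * (norm d)\<^sup>2) (at t)"
      unfolding g_def by (rule derivative_eq_intros f' refl)+ (simp add: inner_diff_left)
    have "(grad f (x + t *\<^sub>R d) - grad f x) \<bullet> d \<le> norm (grad f (x + t *\<^sub>R d) - grad f x) * norm d"
      by (rule norm_cauchy_schwarz)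
    also have "\<dots> \<le> (L * norm (t *\<^sub>R d)) * norm d"
      using lipschitz_onD[OF lip, of "x + t *\<^sub>R d" x] by (intro mult_right_mono) (auto simp: dist_norm)
    also have "\<dots> = L * t * (norm d)\<^sup>2"
      using that by (simp add: power2_eq_square)
    finally show ?thesis
      using g' by fastforce
  qed
  then have "g 1 \<le> g 0"
    by (intro DERIV_nonpos_imp_nonincreasing[of 0 1]) auto
  then show ?thesis
    by (simp add: g_def)
qed

section \<open>Orthogonal decomposition into blocks\<close>

lemma linear_block: "linear (block blk i)"
  by (rule linearI) (auto simp: block_def vec_eq_iff)

lemma sum_block:
  assumes "finite I" "range blk \<subseteq> I"
  shows "(\<Sum>i\<in>I. block blk i x) = x"
proof -
  have "(\<Sum>i\<in>I. if blk c = i then x $ c else 0) = x $ c" for c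
    using assms by (auto simp: sum.delta')
  then show ?thesis
    by (simp add: vec_eq_iff block_def)
qed

lemma inner_block_left: "block blk i x \<bullet> y = block blk i x \<bullet> block blk i y"
  unfolding inner_vec_def by (rule sum.cong) (auto simp: block_def)

text \<open>Distinct blocks have disjoint supports, so the projections are mutually orthogonal. This
  splits both the linearization of \<open>fbar\<close> and, with \<open>x = y\<close>, the squared
  step.\<close>

lemma sum_inner_block:
  assumes "finite I" "range blk \<subseteq> I"
  shows "(\<Sum>i\<in>I. block blk i x \<bullet> block blk i y) = x \<bullet> y"
  by (simp add: inner_block_left[symmetric] sum_block[OF assms] flip: inner_sum_left)

section \<open>The constraint map and the smooth part \<open>fbar\<close>\<close>

lemma linear_sum_matrix_block:
  "linear (\<lambda>x. \<Sum>i\<in>I. (A i :: real^'n^'m) *v block blk i x)"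
  using linear_compose[OF linear_block matrix_vector_mul_linear]
  by (intro linear_compose_sum) (auto simp: o_def)

lemma residual_add:
  "residual blk N A b (x + d) = residual blk N A b x + (\<Sum>i\<in>{1..N}. A i *v block blk i d)"
  unfolding residual_def by (simp add: linear_add[OF linear_sum_matrix_block])

text \<open>Chain rule for the quadratic penalty. Pairing with a direction \<open>d\<close> avoids
  writing the adjoint of the constraint map.\<close>

lemma inner_grad_fbar:
  assumes "f differentiable (at x)"
  shows "grad (fbar blk N f A b \<beta>) x \<bullet> d
    = grad f x \<bullet> d + \<beta> * (residual blk N A b x \<bullet> (\<Sum>i\<in>{1..N}. A i *v block blk i d))"
proof -
  let ?B = "\<lambda>x. \<Sum>i\<in>{1..N}. A i *v block blk i x"
  have B: "(?B has_derivative ?B) (at x)"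
    by (intro linear_imp_has_derivative linear_sum_matrix_block)
  have f: "(f has_derivative (\<lambda>h. h \<bullet> grad f x)) (at x)"
    using GDERIV_grad[OF assms] by (simp add: gderiv_def)
  have "(fbar blk N f A b \<beta> has_derivative
      (\<lambda>h. grad f x \<bullet> h + \<beta> * (residual blk N A b x \<bullet> ?B h))) (at x)"
    unfolding fbar_def[abs_def] residual_def power2_norm_eq_inner
    by (rule derivative_eq_intros B f refl)+ (auto simp: inner_commute algebra_simps)
  then show ?thesis
    by (rule has_derivative_eq_inner_grad[symmetric])
qed

text \<open>The descent lemma handles \<open>f\<close>. The penalty is quadratic, so its expansion
  is exact and its only excess over the linearization is \<open>\<beta> / 2\<close> times the
  squared norm of the image of \<open>d\<close>. The two contributions give
  \<open>L + \<beta> * K\<^sup>2\<close>.\<close>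

lemma fbar_descent:
  assumes diff: "\<And>x. f differentiable (at x)"
    and lip: "L-lipschitz_on UNIV (grad f)"
    and "\<beta> \<ge> 0"
    and K: "\<And>d. norm (\<Sum>i\<in>{1..N}. A i *v block blk i d) \<le> K * norm d"
  shows "fbar blk N f A b \<beta> (x + d) \<le> fbar blk N f A b \<beta> x
    + grad (fbar blk N f A b \<beta>) x \<bullet> d + (L + \<beta> * K\<^sup>2) / 2 * (norm d)\<^sup>2"
proof -
  let ?B = "\<Sum>i\<in>{1..N}. A i *v block blk i d" and ?R = "residual blk N A b x"
  have "(norm ?B)\<^sup>2 \<le> (K * norm d)\<^sup>2"
    by (intro power_mono K) auto
  then have "\<beta> / 2 * (norm ?B)\<^sup>2 \<le> \<beta> / 2 * (K\<^sup>2 * (norm d)\<^sup>2)"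
    using \<open>\<beta> \<ge> 0\<close> by (intro mult_left_mono) (auto simp: power_mult_distrib)
  moreover have "(norm (?R + ?B))\<^sup>2 = (norm ?R)\<^sup>2 + 2 * (?R \<bullet> ?B) + (norm ?B)\<^sup>2"
    by (simp add: power2_norm_eq_inner inner_add inner_commute)
  moreover note descent_lemma[OF diff lip, of x d]
  ultimately show ?thesis
    unfolding inner_grad_fbar[OF diff] residual_add fbar_def by (simp add: field_simps)
qed

section \<open>Block subproblems and the Jacobi step\<close>

lemma sqnorm_mat_uminus: "sqnorm_mat H (- v) = sqnorm_mat H v"
  by (simp add: sqnorm_mat_def linear_neg[OF matrix_vector_mul_linear])

lemma sqnorm_mat_shift:
  "sqnorm_mat (a *\<^sub>R H - c *\<^sub>R mat 1) v = a * sqnorm_mat H v - c * (norm v)\<^sup>2"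
  by (simp add: sqnorm_mat_def matrix_vector_mult_diff_rdistrib scaleR_matrix_vector_assoc[symmetric]
      inner_diff_right power2_norm_eq_inner)

text \<open>The value of \<open>fbar\<close> at \<open>x\<close> and the constraint terms of the
  other blocks are the same at both points and cancel.\<close>

lemma Lbar_diff:
  assumes "i \<in> {1..N}"
  shows "Lbar blk N f r A b \<beta> i z x lam - Lbar blk N f r A b \<beta> i (block blk i x) x lam
    = block_grad blk i (fbar blk N f A b \<beta>) x \<bullet> (z - block blk i x)
      - (A i *v (z - block blk i x)) \<bullet> lam + (r i z - r i (block blk i x))"
  by (simp add: Lbar_def inner_diff_left inner_add_left inner_diff_right
      linear_diff[OF matrix_vector_mul_linear])

text \<open>The old block is feasible by the definition of the update, and the proximal term
  vanishes there, so it serves as the competitor of the minimizer.\<close>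

lemma jacobi_step_optimality:
  assumes "jacobi_update blk N f r A b \<beta> M X H x lam xnew" and i: "i \<in> {1..<N}"
  defines "d \<equiv> block blk i xnew - block blk i x"
  shows "block_grad blk i (fbar blk N f A b \<beta>) x \<bullet> d - (A i *v d) \<bullet> lam
    + (r i (block blk i xnew) - r i (block blk i x)) + 1 / 2 * sqnorm_mat (H i) d \<le> 0"
proof -
  have "Lbar blk N f r A b \<beta> i (block blk i xnew) x lam + 1 / 2 * sqnorm_mat (H i) d
      \<le> Lbar blk N f r A b \<beta> i (block blk i x) x lam + 1 / 2 * sqnorm_mat (H i) 0"
    using assms unfolding jacobi_update_def is_arg_min_linorder d_def by force
  then show ?thesis
    using Lbar_diff[of i N blk f r A b \<beta> "block blk i xnew" x lam] i
    by (simp add: d_def sqnorm_mat_def)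
qed

lemma block_replace_block:
  "block blk i (replace_block blk N y x) = (if i = N then block blk i x else block blk i y)"
  by (auto simp: block_def replace_block_def vec_eq_iff)

text \<open>\<open>Lhat\<close> enters only through a quadratic upper bound for \<open>fbar\<close>
  at the current point, so this part is independent of how the constant is found.\<close>

lemma jacobi_step_descent:
  assumes blocks: "range blk = {1..N}"
    and upd: "jacobi_update blk N f r A b \<beta> M X H x lam xnew"
    and desc: "\<And>d. fbar blk N f A b \<beta> (x + d) \<le> fbar blk N f A b \<beta> x
      + grad (fbar blk N f A b \<beta>) x \<bullet> d + Lhat / 2 * (norm d)\<^sup>2"
  shows "aug_lagrangian blk N f r A b \<beta> (replace_block blk N xnew x) lam
    \<le> aug_lagrangian blk N f r A b \<beta> x lam
      - (\<Sum>i\<in>{1..<N}. sqnorm_mat ((1 / 2) *\<^sub>R H i - (Lhat / 2) *\<^sub>R mat 1)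
          (block blk i x - block blk i xnew))"
proof -
  define y where "y = replace_block blk N xnew x"
  define d where "d = y - x"
  let ?F = "fbar blk N f A b \<beta>" and ?di = "\<lambda>i. block blk i xnew - block blk i x"
  have y: "y = x + d"
    by (simp add: d_def)
  \<comment> \<open>Index types are inhabited, so the range \<open>{1..N}\<close> of
    \<open>blk\<close> is nonempty and block \<open>N\<close> can be peeled off the sums.\<close>
  have "1 \<le> N"
    using blocks by (metis UNIV_not_empty atLeastatMost_empty_iff image_is_empty)
  then have split: "{1..N} = insert N {1..<N}"
    by auto
  have block_d: "block blk i d = (if i = N then 0 else ?di i)" for i
    by (simp add: d_def y_def linear_diff[OF linear_block] block_replace_block)
  have Ad: "(\<Sum>i\<in>{1..N}. A i *v block blk i d) = (\<Sum>i\<in>{1..<N}. A i *v ?di i)"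
    unfolding split by (simp add: block_d)
  have grad: "grad ?F x \<bullet> d = (\<Sum>i\<in>{1..<N}. block_grad blk i ?F x \<bullet> ?di i)"
    using sum_inner_block[of "{1..N}" blk "grad ?F x" d] blocks
    unfolding split by (simp add: block_d block_grad_def)
  have norm: "(norm d)\<^sup>2 = (\<Sum>i\<in>{1..<N}. (norm (?di i))\<^sup>2)"
    using sum_inner_block[of "{1..N}" blk d d] blocks
    unfolding split by (simp add: block_d power2_norm_eq_inner)
  \<comment> \<open>The claim measures old minus new and the subproblem new minus old; the quadratic
    form is even.\<close>
  have "sqnorm_mat ((1 / 2) *\<^sub>R H i - (Lhat / 2) *\<^sub>R mat 1) (block blk i x - block blk i xnew)
      = 1 / 2 * sqnorm_mat (H i) (?di i) - Lhat / 2 * (norm (?di i))\<^sup>2" for i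
    using sqnorm_mat_uminus[of "H i" "?di i"] by (simp add: sqnorm_mat_shift norm_minus_commute)
  then have sq: "(\<Sum>i\<in>{1..<N}. sqnorm_mat ((1 / 2) *\<^sub>R H i - (Lhat / 2) *\<^sub>R mat 1)
      (block blk i x - block blk i xnew))
      = (\<Sum>i\<in>{1..<N}. 1 / 2 * sqnorm_mat (H i) (?di i)) - Lhat / 2 * (norm d)\<^sup>2"
    by (simp add: sum_subtractf norm sum_distrib_left)
  have aug: "aug_lagrangian blk N f r A b \<beta> z lam
      = ?F z + (\<Sum>i\<in>{1..<N}. r i (block blk i z)) - residual blk N A b z \<bullet> lam" for z
    by (simp add: aug_lagrangian_def fbar_def)
  have "(\<Sum>i\<in>{1..<N}. block_grad blk i ?F x \<bullet> ?di i - (A i *v ?di i) \<bullet> lam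
      + (r i (block blk i xnew) - r i (block blk i x)) + 1 / 2 * sqnorm_mat (H i) (?di i)) \<le> 0"
    by (intro sum_nonpos jacobi_step_optimality[OF upd])
  then have "grad ?F x \<bullet> d - (\<Sum>i\<in>{1..N}. A i *v block blk i d) \<bullet> lam
      + ((\<Sum>i\<in>{1..<N}. r i (block blk i xnew)) - (\<Sum>i\<in>{1..<N}. r i (block blk i x)))
      + (\<Sum>i\<in>{1..<N}. 1 / 2 * sqnorm_mat (H i) (?di i)) \<le> 0"
    unfolding grad Ad by (simp only: sum.distrib sum_subtractf inner_sum_left)
  moreover have "(\<Sum>i\<in>{1..<N}. r i (block blk i y)) = (\<Sum>i\<in>{1..<N}. r i (block blk i xnew))"
    by (rule sum.cong) (auto simp: y_def block_replace_block)
  moreover have "residual blk N A b y \<bullet> lam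
      = residual blk N A b x \<bullet> lam + (\<Sum>i\<in>{1..N}. A i *v block blk i d) \<bullet> lam"
    unfolding y residual_add by (rule inner_add_left)
  \<comment> \<open>The linearization, the multiplier term and the change of the \<open>r i\<close>
    occur both in the summed optimality inequality and in the bound from \<open>desc\<close>.
    Eliminating them leaves the proximal terms against \<open>Lhat / 2\<close> times the squared
    step.\<close>
  ultimately show ?thesis
    using desc[of d] unfolding aug sq y_def[symmetric] y[symmetric] by linarith
qed

theorem mainTheorem7:
  fixes N :: nat
    and blk :: "'n::finite \<Rightarrow> nat"
    and \<sigma> :: "'m::finite \<Rightarrow> 'n"
    and A :: "nat \<Rightarrow> real^'n^'m"
    and b :: "real^'m"
    and f :: "real^'n \<Rightarrow> real"
    and r :: "nat \<Rightarrow> real^'n \<Rightarrow> real"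
    and M X :: "nat \<Rightarrow> (real^'n) set"
    and H :: "nat \<Rightarrow> real^'n^'n"
    and L \<beta> :: real
  assumes N: "N \<ge> 2"
    and blocks: "range blk = {1..N}"
    and block_N: "bij_betw \<sigma> UNIV {c. blk c = N}"
    and A_N: "\<And>j j'. A N $ j $ \<sigma> j' = mat 1 $ j $ j'"
    and f_diff: "\<And>x. f differentiable (at x)"
    and L_pos: "L > 0"
    and f_grad: "L-lipschitz_on UNIV (grad f)"
    and r_convex: "\<And>i. i \<in> {1..<N} \<Longrightarrow> convex_on (block_space blk i) (r i)"
    and r_lip: "\<And>i. i \<in> {1..<N} \<Longrightarrow> locally_lipschitz_on (block_space blk i) (r i)"
    and M_mfd: "\<And>i. i \<in> {1..<N} \<Longrightarrow> embedded_submanifold (block_space blk i) (M i)"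
    and X_sub: "\<And>i. i \<in> {1..<N} \<Longrightarrow> X i \<subseteq> block_space blk i"
    and X_closed: "\<And>i. i \<in> {1..<N} \<Longrightarrow> closed (X i)"
    and X_convex: "\<And>i. i \<in> {1..<N} \<Longrightarrow> convex (X i)"
    and beta_pos: "\<beta> > 0"
    and H_spd: "\<And>i. i \<in> {1..<N} \<Longrightarrow> sym_pos_def_block blk i (H i)"
  shows "\<exists>Lhat>0. \<forall>(x :: nat \<Rightarrow> real^'n) (lam :: nat \<Rightarrow> real^'m) k.
           jacobi_update blk N f r A b \<beta> M X H (x k) (lam k) (x (Suc k)) \<longrightarrow>
           aug_lagrangian blk N f r A b \<beta> (replace_block blk N (x (Suc k)) (x k)) (lam k)
             \<le> aug_lagrangian blk N f r A b \<beta> (x k) (lam k)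
                - (\<Sum>i\<in>{1..<N}. sqnorm_mat ((1 / 2) *\<^sub>R H i - (Lhat / 2) *\<^sub>R mat 1)
                                  (block blk i (x k) - block blk i (x (Suc k))))"
proof -
  \<comment> \<open>\<open>K\<close> bounds the constraint map, so it depends only on
    \<open>A\<close>, \<open>blk\<close> and \<open>N\<close>; hence the constant is uniform in the
    iterates.\<close>
  obtain K where K: "norm (\<Sum>i\<in>{1..N}. A i *v block blk i d) \<le> K * norm d" for d
    using linear_bounded[OF linear_sum_matrix_block[of A blk "{1..N}"]] by blast
  \<comment> \<open>Strict positivity comes from \<open>L\<close>; \<open>K\<close> enters squared,
    so its sign does not matter.\<close>
  have "L + \<beta> * K\<^sup>2 > 0"
    using L_pos beta_pos by (intro add_pos_nonneg) auto
  moreover have "fbar blk N f A b \<beta> (z + d) \<le> fbar blk N f A b \<beta> z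
      + grad (fbar blk N f A b \<beta>) z \<bullet> d + (L + \<beta> * K\<^sup>2) / 2 * (norm d)\<^sup>2" for z d
    using beta_pos by (intro fbar_descent f_diff f_grad K) auto
  ultimately show ?thesis
    by (intro exI[of _ "L + \<beta> * K\<^sup>2"] conjI allI impI jacobi_step_descent[OF blocks])
qed

end
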